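(* Let $c\ge2$ be a constant and let $t=t(n)>0$ satisfy $t\big/\left(\frac{\log n}{\sqrt n}\right)^{1/6}\to\infty$. Then there exists a constant $B$ such that, for $\boldsymbol\lambda$ distributed according to the Plancherel measure $\mathbb P_{n,0}(\lambda)=f_\lambda^2/n!$ on partitions of $n$, $$\mathbb P_{n,0}\left(C_{\boldsymbol\lambda}\ge n^{3/2}t\ \text{ and }\ \max(\boldsymbol\lambda_1,\ell(\boldsymbol\lambda))\le c\sqrt n\right)\le\exp[-(B+o(1))nt^6].$$
   Context: For a partition $\lambda\vdash n$, $f_\lambda$ is the number of standard Young tableaux of shape $\lambda$, $\ell(\lambda)$ its number of parts, and $C_\lambda=\sum_{(i,j)\in\lambda}(j-i)$ its content-sum (sum over boxes in row $i$, column $j$). *)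

theory Defs
  imports "HOL-Probability.Probability"
begin

definition partitions_of :: "nat \<Rightarrow> nat list set" where
  "partitions_of n = {\<mu>. sorted_wrt (\<ge>) \<mu> \<and> (\<forall>k\<in>set \<mu>. 0 < k) \<and> sum_list \<mu> = n}"

text \<open>Parts, rows and columns are indexed from 1; parts beyond the length are 0, so that the
  first part of the empty partition is 0.\<close>

definition nth_part :: "nat list \<Rightarrow> nat \<Rightarrow> nat" where
  "nth_part \<mu> i = (if 1 \<le> i \<and> i \<le> length \<mu> then \<mu> ! (i - 1) else 0)"

definition boxes :: "nat list \<Rightarrow> (nat \<times> nat) set" where
  "boxes \<mu> = {(i, j). 1 \<le> i \<and> i \<le> length \<mu> \<and> 1 \<le> j \<and> j \<le> nth_part \<mu> i}"

definition content_sum :: "nat list \<Rightarrow> int" where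
  "content_sum \<mu> = (\<Sum>(i, j)\<in>boxes \<mu>. int j - int i)"

text \<open>Fillings are required to be undefined outside the diagram, so that each tableau is
  counted once.\<close>

definition standard_tableaux :: "nat list \<Rightarrow> (nat \<times> nat \<Rightarrow> nat) set" where
  "standard_tableaux \<mu> = {T \<in> extensional (boxes \<mu>).
     bij_betw T (boxes \<mu>) {1..sum_list \<mu>} \<and>
     (\<forall>i j j'. (i, j) \<in> boxes \<mu> \<and> (i, j') \<in> boxes \<mu> \<and> j < j' \<longrightarrow> T (i, j) < T (i, j')) \<and>
     (\<forall>i i' j. (i, j) \<in> boxes \<mu> \<and> (i', j) \<in> boxes \<mu> \<and> i < i' \<longrightarrow> T (i, j) < T (i', j))}"

definition num_syt :: "nat list \<Rightarrow> nat" where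
  "num_syt \<mu> = card (standard_tableaux \<mu>)"

definition plancherel :: "nat \<Rightarrow> nat list measure" where
  "plancherel n =
     point_measure (partitions_of n) (\<lambda>\<mu>. ennreal ((real (num_syt \<mu>))\<^sup>2 / fact n))"

end

theory Submission
  imports Defs
begin

text \<open>
  For every \<open>x \<noteq> 0\<close>, the sum of \<open>f\<^sub>\<lambda>\<^sup>2 / n! \<cdot> \<Prod>\<^sub>b (1 + c(b) / x)\<close> over the partitions \<open>\<lambda>\<close> of \<open>n\<close>, the product
  being over the boxes \<open>b\<close> of \<open>\<lambda>\<close> with content \<open>c(b)\<close>, equals 1. This follows by induction along the
  Young graph from \<open>\<Sum> f\<^sub>\<mu> (x + c(\<mu>/\<lambda>)) = (n + 1) x f\<^sub>\<lambda>\<close>, where \<open>\<mu>\<close> ranges over the partitions covering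
  \<open>\<lambda>\<close>; that identity is itself an induction using that adding and removing different boxes commute and
  that the addable boxes of \<open>\<lambda>\<close> exceed its removable boxes by 1 in number and by 0 in total content.
  For an integer \<open>x = N > 0\<close> all summands are nonnegative. If all contents are at most \<open>c\<surd>n\<close> in
  absolute value and sum to at least \<open>n\<^sup>3\<^sup>/\<^sup>2t\<close>, then with \<open>N \<approx> 4c\<^sup>2\<surd>n / t\<close> the product is at least
  \<open>exp (n t\<^sup>2 / (16 c\<^sup>2))\<close>, so Markov's inequality bounds the probability by
  \<open>exp (- n t\<^sup>2 / (16 c\<^sup>2))\<close>. Since \<open>t \<le> c\<close> unless the event is empty, this is stronger than a
  bound with \<open>t\<^sup>6\<close>.
\<close>

section \<open>Young diagrams as finite down-closed sets of boxes\<close>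

definition diagram :: "(nat \<times> nat) set \<Rightarrow> bool" where
  "diagram D \<longleftrightarrow> finite D \<and> (\<forall>i j. (i, j) \<in> D \<longrightarrow> 1 \<le> i \<and> 1 \<le> j) \<and>
     (\<forall>i j i' j'. (i, j) \<in> D \<and> 1 \<le> i' \<and> i' \<le> i \<and> 1 \<le> j' \<and> j' \<le> j \<longrightarrow> (i', j') \<in> D)"

definition addable :: "(nat \<times> nat) set \<Rightarrow> (nat \<times> nat) set" where
  "addable D = {b. b \<notin> D \<and> diagram (insert b D)}"

definition removable :: "(nat \<times> nat) set \<Rightarrow> (nat \<times> nat) set" where
  "removable D = {b \<in> D. diagram (D - {b})}"

definition row_length :: "(nat \<times> nat) set \<Rightarrow> nat \<Rightarrow> nat" where
  "row_length D i = card {j. (i, j) \<in> D}"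

text \<open>The counterpart of \<open>standard_tableaux\<close> for sets of boxes instead of lists
  of parts, so that adding or deleting a box is a plain set operation.\<close>

definition increasing_fillings :: "(nat \<times> nat) set \<Rightarrow> (nat \<times> nat \<Rightarrow> nat) set" where
  "increasing_fillings D = {T \<in> extensional D.
     bij_betw T D {1..card D} \<and>
     (\<forall>i j j'. (i, j) \<in> D \<and> (i, j') \<in> D \<and> j < j' \<longrightarrow> T (i, j) < T (i, j')) \<and>
     (\<forall>i i' j. (i, j) \<in> D \<and> (i', j) \<in> D \<and> i < i' \<longrightarrow> T (i, j) < T (i', j))}"

definition num_fillings :: "(nat \<times> nat) set \<Rightarrow> nat" where
  "num_fillings D = card (increasing_fillings D)"

text \<open>For x \<noteq> 0 this is x (1 + c(b) / x), with c(b) the content of b. Clearing the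
  denominator keeps the identities below polynomial in x.\<close>

definition weight :: "real \<Rightarrow> nat \<times> nat \<Rightarrow> real" where
  "weight x b = x + (real (snd b) - real (fst b))"

lemma diagram_finite: "diagram D \<Longrightarrow> finite D"
  by (simp add: diagram_def)

lemma diagram_pos: "diagram D \<Longrightarrow> (i, j) \<in> D \<Longrightarrow> 1 \<le> i \<and> 1 \<le> j"
  unfolding diagram_def by blast

lemma diagram_down:
  "diagram D \<Longrightarrow> (i, j) \<in> D \<Longrightarrow> 1 \<le> i' \<Longrightarrow> i' \<le> i \<Longrightarrow> 1 \<le> j' \<Longrightarrow> j' \<le> j \<Longrightarrow> (i', j') \<in> D"
  unfolding diagram_def by blast

lemma diagram_empty: "diagram {}"
  by (simp add: diagram_def)

lemma diagramI:
  assumes "finite D" "\<And>i j. (i, j) \<in> D \<Longrightarrow> 1 \<le> i \<and> 1 \<le> j"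
    and "\<And>i j i' j'. (i, j) \<in> D \<Longrightarrow> 1 \<le> i' \<Longrightarrow> i' \<le> i \<Longrightarrow> 1 \<le> j' \<Longrightarrow> j' \<le> j \<Longrightarrow> (i', j') \<in> D"
  shows "diagram D"
  using assms unfolding diagram_def by blast

lemma diagram_Int:
  assumes "diagram D" "diagram E" shows "diagram (D \<inter> E)"
proof (rule diagramI)
  show "finite (D \<inter> E)" using assms by (simp add: diagram_finite)
  show "1 \<le> i \<and> 1 \<le> j" if "(i, j) \<in> D \<inter> E" for i j
    using that diagram_pos[OF assms(1), of i j] diagram_pos[OF assms(2), of i j] by fast
  show "(i', j') \<in> D \<inter> E"
    if "(i, j) \<in> D \<inter> E" "1 \<le> i'" "i' \<le> i" "1 \<le> j'" "j' \<le> j" for i j i' j'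
    using that diagram_down[OF assms(1), of i j i' j'] diagram_down[OF assms(2), of i j i' j'] by fast
qed

lemma diagram_Un:
  assumes "diagram D" "diagram E" shows "diagram (D \<union> E)"
proof (rule diagramI)
  show "finite (D \<union> E)" using assms by (simp add: diagram_finite)
  show "1 \<le> i \<and> 1 \<le> j" if "(i, j) \<in> D \<union> E" for i j
    using that diagram_pos[OF assms(1), of i j] diagram_pos[OF assms(2), of i j] by fast
  show "(i', j') \<in> D \<union> E"
    if "(i, j) \<in> D \<union> E" "1 \<le> i'" "i' \<le> i" "1 \<le> j'" "j' \<le> j" for i j i' j'
    using that diagram_down[OF assms(1), of i j i' j'] diagram_down[OF assms(2), of i j i' j'] by fast
qed

lemma finite_down_closed_eq_atLeastAtMost:
  fixes S :: "nat set"
  assumes "finite S" and pos: "\<And>j. j \<in> S \<Longrightarrow> 1 \<le> j"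
    and down: "\<And>j j'. j \<in> S \<Longrightarrow> 1 \<le> j' \<Longrightarrow> j' \<le> j \<Longrightarrow> j' \<in> S"
  shows "S = {1..card S}"
proof (cases "S = {}")
  case False
  have "S \<subseteq> {1..Max S}" using pos Max_ge[OF assms(1)] by (intro subsetI) simp
  moreover have "{1..Max S} \<subseteq> S"
    using down[OF Max_in[OF assms(1) False]] by (intro subsetI) simp
  ultimately have eq: "S = {1..Max S}" by (rule equalityI)
  have "card S = Max S" by (subst eq) simp
  then show ?thesis using eq by simp
qed simp

lemma mem_diagram_iff:
  assumes "diagram D"
  shows "(i, j) \<in> D \<longleftrightarrow> 1 \<le> i \<and> 1 \<le> j \<and> j \<le> row_length D i"
proof -
  let ?S = "{j. (i, j) \<in> D}"
  have "?S \<subseteq> snd ` D" by force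
  then have "finite ?S" by (meson assms diagram_finite finite_imageI finite_subset)
  then have S: "?S = {1..card ?S}"
  proof (rule finite_down_closed_eq_atLeastAtMost)
    show "1 \<le> k" if "k \<in> ?S" for k using that diagram_pos[OF assms, of i k] by simp
    show "k' \<in> ?S" if "k \<in> ?S" "1 \<le> k'" "k' \<le> k" for k k'
      using that diagram_pos[OF assms, of i k] diagram_down[OF assms, of i k i k'] by simp
  qed
  have "j \<in> ?S \<longleftrightarrow> 1 \<le> j \<and> j \<le> row_length D i"
    unfolding row_length_def by (subst S) simp
  then show ?thesis using diagram_pos[OF assms, of i j] by auto
qed

lemma row_length_mono:
  assumes "diagram D" "1 \<le> i" "i \<le> i'"
  shows "row_length D i' \<le> row_length D i"
proof (cases "row_length D i' = 0")
  case False
  then have "(i', row_length D i') \<in> D"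
    using assms by (auto simp: mem_diagram_iff)
  then have "(i, row_length D i') \<in> D"
    using diagram_down[OF assms(1), of i' "row_length D i'" i "row_length D i'"] assms False by auto
  then show ?thesis using assms by (simp add: mem_diagram_iff)
qed simp

section \<open>Removable and addable boxes in terms of row lengths\<close>

lemma removable_iff:
  assumes D: "diagram D"
  shows "(i, j) \<in> removable D \<longleftrightarrow> 1 \<le> i \<and> j = row_length D i \<and> row_length D (Suc i) < row_length D i"
proof
  assume "(i, j) \<in> removable D"
  then have ij: "(i, j) \<in> D" and D': "diagram (D - {(i, j)})" by (auto simp: removable_def)
  have "(i, Suc j) \<notin> D" "(Suc i, j) \<notin> D"
    using diagram_down[OF D', of i "Suc j" i j] diagram_down[OF D', of "Suc i" j i j]
      diagram_pos[OF D ij] by auto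
  then show "1 \<le> i \<and> j = row_length D i \<and> row_length D (Suc i) < row_length D i"
    using ij by (auto simp: mem_diagram_iff[OF D])
next
  assume a: "1 \<le> i \<and> j = row_length D i \<and> row_length D (Suc i) < row_length D i"
  then have ij: "(i, j) \<in> D" by (auto simp: mem_diagram_iff[OF D])
  \<comment> \<open>Nothing else lies weakly below and to the right of the box: every lower row has
    length at most \<open>row_length D (Suc i)\<close>, which is smaller than j.\<close>
  have max: "(k, l) = (i, j)" if "(k, l) \<in> D" "i \<le> k" "j \<le> l" for k l
  proof -
    have l: "l \<le> row_length D k" using that by (simp add: mem_diagram_iff[OF D])
    have "k = i"
    proof (rule ccontr)
      assume "k \<noteq> i"
      then have "row_length D k \<le> row_length D (Suc i)"
        using row_length_mono[OF D, of "Suc i" k] that by auto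
      then show False using l a that by auto
    qed
    then show ?thesis using l a that by auto
  qed
  have "diagram (D - {(i, j)})"
  proof (rule diagramI)
    show "finite (D - {(i, j)})" using D by (simp add: diagram_finite)
  next
    fix k l k' l' assume h: "(k, l) \<in> D - {(i, j)}" "1 \<le> k'" "k' \<le> k" "1 \<le> l'" "l' \<le> l"
    then have "(k', l') \<in> D" using diagram_down[OF D, of k l k' l'] by simp
    moreover have "(k', l') \<noteq> (i, j)" using max[of k l] h by auto
    ultimately show "(k', l') \<in> D - {(i, j)}" by blast
  next
    fix k l assume "(k, l) \<in> D - {(i, j)}"
    then show "1 \<le> k \<and> 1 \<le> l" using diagram_pos[OF D, of k l] by simp
  qed
  then show "(i, j) \<in> removable D" using ij by (simp add: removable_def)
qed

lemma addable_iff: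
  assumes D: "diagram D"
  shows "(i, j) \<in> addable D \<longleftrightarrow>
    1 \<le> i \<and> j = Suc (row_length D i) \<and> (i = 1 \<or> row_length D i < row_length D (i - 1))"
proof
  assume "(i, j) \<in> addable D"
  then have ij: "(i, j) \<notin> D" and D': "diagram (insert (i, j) D)" by (auto simp: addable_def)
  have p: "1 \<le> i" "1 \<le> j" using diagram_pos[OF D', of i j] by auto
  have left: "(i, j - 1) \<in> D" if "j \<noteq> 1"
    using diagram_down[OF D', of i j i "j - 1"] p that by (cases j) auto
  have above: "(i - 1, j) \<in> D" if "i \<noteq> 1"
    using diagram_down[OF D', of i j "i - 1" j] p that by (cases i) auto
  have gt: "row_length D i < j" using ij p by (simp add: mem_diagram_iff[OF D])
  have "j - 1 \<le> row_length D i" using left by (cases "j = 1") (simp_all add: mem_diagram_iff[OF D])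
  then have "j = Suc (row_length D i)" using gt by simp
  moreover have "i = 1 \<or> row_length D i < row_length D (i - 1)"
    using above gt by (cases "i = 1") (simp_all add: mem_diagram_iff[OF D])
  ultimately show "1 \<le> i \<and> j = Suc (row_length D i) \<and> (i = 1 \<or> row_length D i < row_length D (i - 1))"
    using p by blast
next
  assume a: "1 \<le> i \<and> j = Suc (row_length D i) \<and> (i = 1 \<or> row_length D i < row_length D (i - 1))"
  then have ij: "(i, j) \<notin> D" by (auto simp: mem_diagram_iff[OF D])
  \<comment> \<open>A row k above row i is at least as long as row i - 1, hence has length at least
    j.\<close>
  have below: "(k, l) \<in> insert (i, j) D" if "1 \<le> k" "k \<le> i" "1 \<le> l" "l \<le> j" for k l
  proof (cases "k = i")
    case True
    then show ?thesis using that a by (auto simp: le_Suc_eq mem_diagram_iff[OF D])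
  next
    case False
    then have "row_length D (i - 1) \<le> row_length D k"
      using row_length_mono[OF D, of k "i - 1"] that by auto
    then show ?thesis using that a False by (auto simp: mem_diagram_iff[OF D])
  qed
  have "diagram (insert (i, j) D)"
  proof (rule diagramI)
    show "finite (insert (i, j) D)" using D by (simp add: diagram_finite)
  next
    fix k l k' l' assume "(k, l) \<in> insert (i, j) D" "1 \<le> k'" "k' \<le> k" "1 \<le> l'" "l' \<le> l"
    then show "(k', l') \<in> insert (i, j) D" using diagram_down[OF D, of k l k' l'] below[of k' l'] by auto
  next
    fix k l assume "(k, l) \<in> insert (i, j) D"
    then show "1 \<le> k \<and> 1 \<le> l" using a diagram_pos[OF D, of k l] by auto
  qed
  then show "(i, j) \<in> addable D" using ij by (simp add: addable_def)
qed

lemma finite_removable: "diagram D \<Longrightarrow> finite (removable D)"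
  by (simp add: removable_def diagram_finite)

text \<open>Below the first row, the addable box of row \<open>i + 1\<close> is paired with the removable box of row
  \<open>i\<close>; the difference of their contents is the difference of the two row lengths.\<close>

lemma addable_removable_weights:
  assumes D: "diagram D"
  shows "finite (addable D)"
    and "(\<Sum>a\<in>addable D. weight x a) - (\<Sum>b\<in>removable D. weight x b) = x"
proof -
  let ?r = "row_length D"
  obtain m where m: "\<And>i j. (i, j) \<in> D \<Longrightarrow> i \<le> m"
  proof -
    have "finite (fst ` D)" using D by (simp add: diagram_finite)
    then obtain m where "\<forall>i\<in>fst ` D. i \<le> m" using finite_nat_set_iff_bounded_le by blast
    then show ?thesis using that by force
  qed
  have r0: "?r (Suc m) = 0"
  proof (rule ccontr)
    assume "?r (Suc m) \<noteq> 0"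
    then have "(Suc m, 1) \<in> D" by (auto simp: mem_diagram_iff[OF D])
    then show False using m by fastforce
  qed
  \<comment> \<open>J indexes the rows ending in a removable box. Shifted down by one row, it also
    indexes all addable boxes except the one in row 1.\<close>
  define J where "J = {i \<in> {1..m}. ?r (Suc i) < ?r i}"
  have J_iff: "i \<in> J \<longleftrightarrow> 1 \<le> i \<and> ?r (Suc i) < ?r i" for i
  proof
    assume h: "1 \<le> i \<and> ?r (Suc i) < ?r i"
    then have "(i, ?r i) \<in> D" by (auto simp: mem_diagram_iff[OF D])
    then show "i \<in> J" using h m by (auto simp: J_def)
  qed (auto simp: J_def)
  have rem: "removable D = (\<lambda>i. (i, ?r i)) ` J"
    using removable_iff[OF D] J_iff by auto
  have add: "addable D = insert (1, Suc (?r 1)) ((\<lambda>i. (Suc i, Suc (?r (Suc i)))) ` J)"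
  proof (intro set_eqI iffI)
    fix b assume "b \<in> addable D"
    then obtain i j where b: "b = (i, j)" "(i, j) \<in> addable D" by (cases b) auto
    show "b \<in> insert (1, Suc (?r 1)) ((\<lambda>i. (Suc i, Suc (?r (Suc i)))) ` J)"
    proof (cases "i = 1")
      case False
      then have "i - 1 \<in> J" "b = (Suc (i - 1), Suc (?r (Suc (i - 1))))"
        using b addable_iff[OF D, of i j] by (auto simp: J_iff)
      then show ?thesis by blast
    qed (use b addable_iff[OF D, of i j] in auto)
  qed (use addable_iff[OF D] J_iff in auto)
  show "finite (addable D)" unfolding add J_def by simp
  have notin: "(1, Suc (?r 1)) \<notin> (\<lambda>i. (Suc i, Suc (?r (Suc i)))) ` J"
    using J_iff by auto
  have "(\<Sum>a\<in>addable D. weight x a) =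
      weight x (1, Suc (?r 1)) + (\<Sum>i\<in>J. weight x (Suc i, Suc (?r (Suc i))))"
    unfolding add using notin by (subst sum.insert) (auto simp: J_def sum.reindex inj_on_def)
  moreover have "(\<Sum>b\<in>removable D. weight x b) = (\<Sum>i\<in>J. weight x (i, ?r i))"
    unfolding rem by (subst sum.reindex) (auto simp: inj_on_def)
  moreover have "(\<Sum>i\<in>J. weight x (Suc i, Suc (?r (Suc i)))) - (\<Sum>i\<in>J. weight x (i, ?r i))
      = (\<Sum>i\<in>J. real (?r (Suc i)) - real (?r i))"
    unfolding sum_subtractf[symmetric] by (rule sum.cong) (auto simp: weight_def)
  \<comment> \<open>A row outside J is as long as the next one, so the sum extends to all rows and
    telescopes to minus the length of row 1. This cancels the content of the addable box in row 1
    and leaves x.\<close>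
  moreover have "(\<Sum>i\<in>J. real (?r (Suc i)) - real (?r i)) = (\<Sum>i=1..m. real (?r (Suc i)) - real (?r i))"
  proof (rule sum.mono_neutral_left)
    show "\<forall>i\<in>{1..m} - J. real (?r (Suc i)) - real (?r i) = 0"
    proof
      fix i assume "i \<in> {1..m} - J"
      then have "?r i \<le> ?r (Suc i)" "?r (Suc i) \<le> ?r i"
        using row_length_mono[OF D, of i "Suc i"] J_iff[of i] by auto
      then show "real (?r (Suc i)) - real (?r i) = 0" by simp
    qed
  qed (auto simp: J_def)
  moreover have "(\<Sum>i=1..m. real (?r (Suc i)) - real (?r i)) = real (?r (Suc m)) - real (?r 1)"
    by (subst sum_Suc_diff) auto
  ultimately show "(\<Sum>a\<in>addable D. weight x a) - (\<Sum>b\<in>removable D. weight x b) = x"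
    using r0 by (simp add: weight_def)
qed

section \<open>Increasing fillings and the branching rule\<close>

lemma finite_increasing_fillings:
  assumes "finite D" shows "finite (increasing_fillings D)"
proof (rule finite_subset)
  show "increasing_fillings D \<subseteq> D \<rightarrow>\<^sub>E {1..card D}"
    by (auto simp: increasing_fillings_def PiE_def bij_betw_def)
qed (use assms in \<open>auto intro: finite_PiE\<close>)

lemma num_fillings_empty: "num_fillings {} = 1"
proof -
  have "increasing_fillings {} = {\<lambda>_. undefined}"
    by (auto simp: increasing_fillings_def extensional_def bij_betw_def)
  then show ?thesis by (simp add: num_fillings_def)
qed

text \<open>A box to the right of b or below it would need an entry exceeding the maximum
  \<open>card E\<close>.\<close>

lemma last_box_removable:
  assumes E: "diagram E" and T: "T \<in> increasing_fillings E" and b: "b \<in> E" "T b = card E"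
  shows "b \<in> removable E"
proof -
  have le: "T a \<le> card E" if "a \<in> E" for a
    using T that by (auto simp: increasing_fillings_def bij_betw_def)
  obtain i j where ij: "b = (i, j)" by (cases b) auto
  have row: "(i, j') \<notin> E" if "j < j'" for j'
    using T b ij that le[of "(i, j')"] unfolding increasing_fillings_def
    by (metis (mono_tags, lifting) leD mem_Collect_eq)
  have col: "(i', j) \<notin> E" if "i < i'" for i'
    using T b ij that le[of "(i', j)"] unfolding increasing_fillings_def
    by (metis (mono_tags, lifting) leD mem_Collect_eq)
  have "1 \<le> i" "j = row_length E i"
    using b(1) row[of "Suc j"] unfolding ij by (auto simp: mem_diagram_iff[OF E])
  moreover have "row_length E (Suc i) < row_length E i"
    using b(1) col[of "Suc i"] calculation unfolding ij by (auto simp: mem_diagram_iff[OF E])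
  ultimately show ?thesis using removable_iff[OF E] ij by blast
qed

text \<open>Erasing the largest entry and writing it back into b are mutually inverse.\<close>

lemma card_fillings_with_last_box:
  assumes E: "diagram E" and b: "b \<in> removable E"
  shows "card {T \<in> increasing_fillings E. T b = card E} = num_fillings (E - {b})"
proof -
  have bE: "b \<in> E" and fin: "finite E" and D': "diagram (E - {b})"
    using b E by (auto simp: removable_def diagram_finite)
  have cE: "card E = Suc (card (E - {b}))" using bE fin by (metis card_Suc_Diff1)
  have bij: "bij_betw (\<lambda>T. restrict T (E - {b})) {T \<in> increasing_fillings E. T b = card E}
      (increasing_fillings (E - {b}))"
  proof (rule bij_betwI[where g = "\<lambda>T. T(b := card E)"])
    show "(\<lambda>T. restrict T (E - {b})) \<in> {T \<in> increasing_fillings E. T b = card E} \<rightarrow>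
        increasing_fillings (E - {b})"
    proof
      fix T assume "T \<in> {T \<in> increasing_fillings E. T b = card E}"
      then have T: "T \<in> increasing_fillings E" and Tb: "T b = card E" by auto
      have "bij_betw T E {1..card E}" using T by (simp add: increasing_fillings_def)
      then have "bij_betw T (E - {b}) ({1..card E} - {card E})"
        using bE Tb by (metis bij_betw_DiffI bij_betw_singletonI empty_subsetI insert_subset
            bij_betw_apply)
      moreover have "{1..card E} - {card E} = {1..card (E - {b})}" using cE by auto
      ultimately have "bij_betw (restrict T (E - {b})) (E - {b}) {1..card (E - {b})}"
        by (metis (no_types, lifting) bij_betw_cong restrict_apply')
      then show "restrict T (E - {b}) \<in> increasing_fillings (E - {b})"
        using T by (auto simp: increasing_fillings_def)
    qed
    show "(\<lambda>T. T(b := card E)) \<in> increasing_fillings (E - {b}) \<rightarrow>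
        {T \<in> increasing_fillings E. T b = card E}"
    proof
      fix T assume T: "T \<in> increasing_fillings (E - {b})"
      let ?T = "T(b := card E)"
      have bT: "bij_betw T (E - {b}) {1..card (E - {b})}"
        using T by (simp add: increasing_fillings_def)
      have lt: "T a < card E" if "a \<in> E - {b}" for a
        using bij_betw_apply[OF bT that] cE by auto
      have bT': "bij_betw ?T E {1..card E}"
      proof -
        have "bij_betw ?T (E - {b}) {1..card (E - {b})}"
          using bT by (metis (no_types, lifting) DiffD2 bij_betw_cong fun_upd_apply singletonI)
        then have "bij_betw ?T (insert b (E - {b})) (insert (?T b) {1..card (E - {b})})"
          by (subst notIn_Un_bij_betw3[symmetric, of b, simplified]) (use cE in auto)
        moreover have "insert b (E - {b}) = E" using bE by auto
        moreover have "insert (?T b) {1..card (E - {b})} = {1..card E}" using cE by auto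
        ultimately show ?thesis by simp
      qed
      \<comment> \<open>Otherwise down-closure of \<open>E - {b}\<close> would put b into
        \<open>E - {b}\<close>. Hence the new largest entry never precedes another entry in its row
        or column.\<close>
      have nomax: "\<not> (fst b \<le> i \<and> snd b \<le> j)" if "(i, j) \<in> E - {b}" for i j
      proof
        assume "fst b \<le> i \<and> snd b \<le> j"
        then have "(fst b, snd b) \<in> E - {b}"
          using diagram_down[OF D' that, of "fst b" "snd b"]
            diagram_pos[OF E, of "fst b" "snd b"] bE by auto
        then show False by simp
      qed
      have inc: "?T (i, j) < ?T (i', j')"
        if "(i, j) \<in> E" "(i', j') \<in> E" "i = i' \<and> j < j' \<or> j = j' \<and> i < i'" for i j i' j'
      proof -
        have ne: "(i, j) \<noteq> b" using nomax[of i' j'] that by auto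
        show ?thesis
        proof (cases "(i', j') = b")
          case True
          then show ?thesis using ne lt[of "(i, j)"] that by auto
        next
          case False
          then show ?thesis using ne that T by (auto simp: increasing_fillings_def)
        qed
      qed
      have "?T \<in> extensional E"
        using T bE by (auto simp: increasing_fillings_def extensional_def)
      then show "?T \<in> {T \<in> increasing_fillings E. T b = card E}"
        using bT' inc by (auto simp: increasing_fillings_def simp del: fun_upd_apply) auto
    qed
  next
    fix T assume "T \<in> {T \<in> increasing_fillings E. T b = card E}"
    then show "(restrict T (E - {b}))(b := card E) = T"
      by (auto simp: increasing_fillings_def extensional_def fun_eq_iff)
  next
    fix T assume "T \<in> increasing_fillings (E - {b})"
    then show "restrict (T(b := card E)) (E - {b}) = T"
      by (auto simp: increasing_fillings_def extensional_def fun_eq_iff)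
  qed
  then show ?thesis unfolding num_fillings_def by (rule bij_betw_same_card)
qed

text \<open>The fillings are classified by the box holding the largest entry; injectivity makes the
  classes disjoint. The empty diagram is excluded because it has one filling but no removable
  box.\<close>

lemma num_fillings_branching:
  assumes E: "diagram E" and ne: "E \<noteq> {}"
  shows "num_fillings E = (\<Sum>b\<in>removable E. num_fillings (E - {b}))"
proof -
  let ?F = "\<lambda>b. {T \<in> increasing_fillings E. T b = card E}"
  have fin: "finite E" using E by (rule diagram_finite)
  have "increasing_fillings E = (\<Union>b\<in>removable E. ?F b)"
  proof (intro equalityI subsetI)
    fix T assume T: "T \<in> increasing_fillings E"
    then have "T ` E = {1..card E}" by (simp add: increasing_fillings_def bij_betw_def)
    moreover have "card E \<in> {1..card E}" using fin ne by (simp add: Suc_leI card_gt_0_iff)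
    ultimately obtain b where "b \<in> E" "T b = card E" by (metis imageE)
    then show "T \<in> (\<Union>b\<in>removable E. ?F b)" using last_box_removable[OF E T] T by blast
  qed auto
  then have "num_fillings E = card (\<Union>b\<in>removable E. ?F b)" by (simp add: num_fillings_def)
  also have "\<dots> = (\<Sum>b\<in>removable E. card (?F b))"
  proof (rule card_UN_disjoint)
    show "\<forall>b\<in>removable E. \<forall>b'\<in>removable E. b \<noteq> b' \<longrightarrow> ?F b \<inter> ?F b' = {}"
    proof (intro ballI impI equals0I)
      fix b b' T assume h: "b \<in> removable E" "b' \<in> removable E" "b \<noteq> b'" "T \<in> ?F b \<inter> ?F b'"
      then have "inj_on T E" "T b = T b'" "b \<in> E" "b' \<in> E"
        by (auto simp: increasing_fillings_def removable_def bij_betw_def)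
      then show False using h(3) by (simp add: inj_on_eq_iff)
    qed
  qed (use finite_removable[OF E] finite_increasing_fillings[OF fin] in auto)
  also have "\<dots> = (\<Sum>b\<in>removable E. num_fillings (E - {b}))"
    using card_fillings_with_last_box[OF E] by simp
  finally show ?thesis .
qed

section \<open>Commuting additions with removals, and the weighted sum over covers\<close>

lemma add_remove_commute:
  assumes D: "diagram D"
  shows "(a \<in> addable D \<and> b \<in> removable (insert a D) \<and> b \<noteq> a) \<longleftrightarrow>
    (b \<in> removable D \<and> a \<in> addable (D - {b}) \<and> a \<noteq> b)"
proof
  assume h: "a \<in> addable D \<and> b \<in> removable (insert a D) \<and> b \<noteq> a"
  \<comment> \<open>Diagrams are closed under intersection and union. Each direction obtains the
    missing diagram in one of these two ways, the converse from a union.\<close>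
  then have "D - {b} = (insert a D - {b}) \<inter> D" "insert a (D - {b}) = insert a D - {b}"
    by (auto simp: addable_def)
  moreover have "diagram ((insert a D - {b}) \<inter> D)"
    using h D by (auto simp: removable_def intro: diagram_Int)
  ultimately show "b \<in> removable D \<and> a \<in> addable (D - {b}) \<and> a \<noteq> b"
    using h by (auto simp: removable_def addable_def)
next
  assume h: "b \<in> removable D \<and> a \<in> addable (D - {b}) \<and> a \<noteq> b"
  then have "insert a D = D \<union> insert a (D - {b})" "insert a (D - {b}) = insert a D - {b}"
    by (auto simp: addable_def)
  moreover have "diagram (D \<union> insert a (D - {b}))"
    using h D by (intro diagram_Un) (auto simp: addable_def)
  ultimately show "a \<in> addable D \<and> b \<in> removable (insert a D) \<and> b \<noteq> a"
    using h by (auto simp: removable_def addable_def)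
qed

text \<open>For \<open>x \<noteq> 0\<close> this makes \<open>D \<mapsto> num_fillings D * (\<Prod>b\<in>D. weight x b) / (n! x\<^sup>n)\<close>, with
  \<open>n = card D\<close>, a harmonic function on the Young graph.\<close>

lemma weighted_up_sum:
  assumes "diagram D"
  shows "(\<Sum>a\<in>addable D. weight x a * real (num_fillings (insert a D))) =
    real (Suc (card D)) * x * real (num_fillings D)"
  using assms
proof (induction "card D" arbitrary: D rule: less_induct)
  case less
  note D = less.prems
  let ?f = "\<lambda>D. real (num_fillings D)"
  let ?A = "addable D" and ?R = "removable D"
  have finA: "finite (addable E)" if "diagram E" for E
    using addable_removable_weights(1) that .
  have finR: "finite ?R" using D by (rule finite_removable)
  have branch: "?f E = (\<Sum>b\<in>removable E. ?f (E - {b}))" if "diagram E" "E \<noteq> {}" for E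
    using num_fillings_branching[OF that] by simp
  \<comment> \<open>Branching for \<open>insert a D\<close>, with the removal of a itself split off;
    that term gives back D.\<close>
  have up: "?f (insert a D) = ?f D + (\<Sum>b\<in>removable (insert a D) - {a}. ?f (insert a D - {b}))"
    if a: "a \<in> ?A" for a
  proof -
    have E: "diagram (insert a D)" and nD: "insert a D - {a} = D" "a \<in> removable (insert a D)"
      using a D by (auto simp: addable_def removable_def)
    show ?thesis
      using branch[OF E] nD by (simp add: sum.remove[OF finite_removable[OF E] nD(2)])
  qed
  \<comment> \<open>The induction hypothesis for \<open>D - {b}\<close>, with the re-addition of b
    split off; that term gives back D.\<close>
  have down: "(\<Sum>a\<in>addable (D - {b}) - {b}. weight x a * ?f (insert a (D - {b}))) =
      real (card D) * x * ?f (D - {b}) - weight x b * ?f D" if b: "b \<in> ?R" for b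
  proof -
    have E: "diagram (D - {b})" and bD: "b \<in> D" using b by (auto simp: removable_def)
    have ba: "b \<in> addable (D - {b})" and ins: "insert b (D - {b}) = D"
      using bD D by (auto simp: addable_def insert_absorb)
    have c: "card D = Suc (card (D - {b}))"
      using bD D by (metis card_Suc_Diff1 diagram_finite)
    have "(\<Sum>a\<in>addable (D - {b}). weight x a * ?f (insert a (D - {b}))) =
        real (card D) * x * ?f (D - {b})"
      using less.hyps[of "D - {b}"] E c by simp
    then show ?thesis using ins by (simp add: sum.remove[OF finA[OF E] ba])
  qed
  have total: "(\<Sum>b\<in>?R. real (card D) * x * ?f (D - {b})) = real (card D) * x * ?f D"
  proof (cases "D = {}")
    case False
    then show ?thesis using branch[OF D False] by (simp add: sum_distrib_left)
  qed (simp add: removable_def)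
  have "(\<Sum>a\<in>?A. weight x a * ?f (insert a D)) = (\<Sum>a\<in>?A. weight x a) * ?f D +
      (\<Sum>a\<in>?A. \<Sum>b\<in>removable (insert a D) - {a}. weight x a * ?f (insert a D - {b}))"
    using up by (simp add: distrib_left sum.distrib sum_distrib_left sum_distrib_right)
  also have "(\<Sum>a\<in>?A. \<Sum>b\<in>removable (insert a D) - {a}. weight x a * ?f (insert a D - {b})) =
      (\<Sum>(a, b)\<in>(SIGMA a:?A. removable (insert a D) - {a}). weight x a * ?f (insert a D - {b}))"
    using finA[OF D] by (subst sum.Sigma) (auto simp: addable_def finite_removable)
  \<comment> \<open>With the returning pairs gone, adding a and then removing b is the same as
    removing b and then adding a.\<close>
  also have "\<dots> = (\<Sum>(b, a)\<in>(SIGMA b:?R. addable (D - {b}) - {b}). weight x a * ?f (insert a (D - {b})))"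
  proof (rule sum.reindex_bij_witness[of _ prod.swap prod.swap])
    fix p assume p: "p \<in> (SIGMA a:?A. removable (insert a D) - {a})"
    obtain a b where ab: "p = (a, b)" by (cases p)
    have "insert a D - {b} = insert a (D - {b})" using p ab by auto
    then show "(case prod.swap p of (b, a) \<Rightarrow> weight x a * ?f (insert a (D - {b}))) =
        (case p of (a, b) \<Rightarrow> weight x a * ?f (insert a D - {b}))"
      using ab by simp
    show "prod.swap p \<in> (SIGMA b:?R. addable (D - {b}) - {b})"
      using p ab add_remove_commute[OF D, of a b] by auto
  next
    fix p assume p: "p \<in> (SIGMA b:?R. addable (D - {b}) - {b})"
    obtain a b where ab: "p = (b, a)" by (cases p)
    show "prod.swap p \<in> (SIGMA a:?A. removable (insert a D) - {a})"
      using p ab add_remove_commute[OF D, of a b] by auto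
  qed auto
  also have "\<dots> = (\<Sum>b\<in>?R. \<Sum>a\<in>addable (D - {b}) - {b}. weight x a * ?f (insert a (D - {b})))"
    using finR by (subst sum.Sigma) (auto simp: removable_def finA)
  also have "\<dots> = real (card D) * x * ?f D - (\<Sum>b\<in>?R. weight x b) * ?f D"
    using down total by (simp add: sum_subtractf sum_distrib_right)
  finally have "(\<Sum>a\<in>?A. weight x a * ?f (insert a D)) =
      ((\<Sum>a\<in>?A. weight x a) - (\<Sum>b\<in>?R. weight x b)) * ?f D + real (card D) * x * ?f D"
    by (simp add: algebra_simps)
  then show ?case
    unfolding addable_removable_weights(2)[OF D] by (simp add: algebra_simps)
qed

section \<open>The weighted sum of squares over all diagrams of a given size\<close>

lemma diagram_subset_square:
  assumes "diagram D"
  shows "D \<subseteq> {1..card D} \<times> {1..card D}"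
proof
  fix b assume "b \<in> D"
  then obtain i j where b: "b = (i, j)" and ij: "(i, j) \<in> D" by (cases b) auto
  have p: "1 \<le> i" "1 \<le> j" using diagram_pos[OF assms ij] by auto
  \<comment> \<open>A box brings with it the column above it and the row to its left, so neither
    coordinate can exceed the number of boxes.\<close>
  have "(\<lambda>k. (k, j)) ` {1..i} \<subseteq> D" "(\<lambda>k. (i, k)) ` {1..j} \<subseteq> D"
    using diagram_down[OF assms ij] p by auto
  then have "card ((\<lambda>k. (k, j)) ` {1..i}) \<le> card D" "card ((\<lambda>k. (i, k)) ` {1..j}) \<le> card D"
    using card_mono[OF diagram_finite[OF assms]] by blast+
  then show "b \<in> {1..card D} \<times> {1..card D}"
    using b p by (simp add: card_image inj_on_def)
qed

definition diagrams :: "nat \<Rightarrow> (nat \<times> nat) set set" where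
  "diagrams n = {D. diagram D \<and> card D = n}"

lemma finite_diagrams: "finite (diagrams n)"
proof (rule finite_subset)
  show "diagrams n \<subseteq> Pow ({1..n} \<times> {1..n})"
    using diagram_subset_square unfolding diagrams_def by blast
qed simp

text \<open>One factor of each square is expanded by the branching rule. Regrouped by the smaller
  diagram, the inner sum is the one in \<open>weighted_up_sum\<close>, which contributes the factor
  (n + 1) x of the induction step.\<close>

lemma sum_squares_weighted:
  "(\<Sum>D\<in>diagrams n. (real (num_fillings D))\<^sup>2 * (\<Prod>b\<in>D. weight x b)) = fact n * x ^ n"
proof (induction n)
  case 0
  have "diagrams 0 = {{}}"
    using diagram_empty by (auto simp: diagrams_def diagram_finite)
  then show ?case by (simp add: num_fillings_empty)
next
  case (Suc n)
  let ?f = "\<lambda>D. real (num_fillings D)" and ?W = "\<lambda>D. \<Prod>b\<in>D. weight x b"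
  have "(\<Sum>E\<in>diagrams (Suc n). (?f E)\<^sup>2 * ?W E) =
      (\<Sum>E\<in>diagrams (Suc n). \<Sum>b\<in>removable E. ?f (E - {b}) * ?f E * ?W E)"
  proof (rule sum.cong)
    fix E assume "E \<in> diagrams (Suc n)"
    then have "diagram E" "E \<noteq> {}" by (auto simp: diagrams_def)
    then have "?f E = (\<Sum>b\<in>removable E. ?f (E - {b}))"
      by (simp add: num_fillings_branching)
    then have "(?f E)\<^sup>2 * ?W E = (\<Sum>b\<in>removable E. ?f (E - {b})) * (?f E * ?W E)"
      by (simp add: power2_eq_square)
    also have "\<dots> = (\<Sum>b\<in>removable E. ?f (E - {b}) * ?f E * ?W E)"
      by (simp add: sum_distrib_right mult.assoc)
    finally show "(?f E)\<^sup>2 * ?W E = (\<Sum>b\<in>removable E. ?f (E - {b}) * ?f E * ?W E)" .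
  qed simp
  also have "\<dots> = (\<Sum>(E, b)\<in>(SIGMA E:diagrams (Suc n). removable E). ?f (E - {b}) * ?f E * ?W E)"
    by (subst sum.Sigma) (use finite_diagrams in \<open>auto simp: finite_removable diagrams_def\<close>)
  also have "\<dots> = (\<Sum>(D, a)\<in>(SIGMA D:diagrams n. addable D).
      ?f D * ?W D * (weight x a * ?f (insert a D)))"
  proof (rule sum.reindex_bij_witness[of _ "\<lambda>(D, a). (insert a D, a)" "\<lambda>(E, b). (E - {b}, b)"])
    fix p assume p: "p \<in> (SIGMA E:diagrams (Suc n). removable E)"
    obtain E b where Eb: "p = (E, b)" by (cases p)
    have E: "diagram E" "card E = Suc n" "b \<in> E" "diagram (E - {b})" "finite E" "insert b E = E"
      using p Eb by (auto simp: diagrams_def removable_def diagram_finite)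
    show "(case case p of (E, b) \<Rightarrow> (E - {b}, b) of (D, a) \<Rightarrow> (insert a D, a)) = p"
      using Eb E by auto
    show "(case p of (E, b) \<Rightarrow> (E - {b}, b)) \<in> (SIGMA D:diagrams n. addable D)"
      using Eb E by (auto simp: diagrams_def addable_def)
    have "?W E = weight x b * ?W (E - {b})" using E by (simp add: prod.remove)
    then show "(case case p of (E, b) \<Rightarrow> (E - {b}, b) of
        (D, a) \<Rightarrow> ?f D * ?W D * (weight x a * ?f (insert a D))) =
        (case p of (E, b) \<Rightarrow> ?f (E - {b}) * ?f E * ?W E)"
      using Eb E by simp
  next
    fix p assume p: "p \<in> (SIGMA D:diagrams n. addable D)"
    obtain D a where Da: "p = (D, a)" by (cases p)
    have D: "diagram D" "card D = n" "a \<notin> D" "diagram (insert a D)" "finite D"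
      using p Da by (auto simp: diagrams_def addable_def diagram_finite)
    show "(case case p of (D, a) \<Rightarrow> (insert a D, a) of (E, b) \<Rightarrow> (E - {b}, b)) = p"
      using Da D by auto
    show "(case p of (D, a) \<Rightarrow> (insert a D, a)) \<in> (SIGMA E:diagrams (Suc n). removable E)"
      using Da D by (auto simp: diagrams_def removable_def)
  qed
  also have "\<dots> = (\<Sum>D\<in>diagrams n. \<Sum>a\<in>addable D. ?f D * ?W D * (weight x a * ?f (insert a D)))"
    by (subst sum.Sigma) (use finite_diagrams in \<open>auto simp: addable_removable_weights(1) diagrams_def\<close>)
  also have "\<dots> = (\<Sum>D\<in>diagrams n. real (Suc n) * x * ((?f D)\<^sup>2 * ?W D))"
  proof (rule sum.cong)
    fix D assume "D \<in> diagrams n"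
    then have "(\<Sum>a\<in>addable D. weight x a * ?f (insert a D)) = real (Suc n) * x * ?f D"
      using weighted_up_sum[of D x] by (simp add: diagrams_def)
    then show "(\<Sum>a\<in>addable D. ?f D * ?W D * (weight x a * ?f (insert a D))) =
        real (Suc n) * x * ((?f D)\<^sup>2 * ?W D)"
      unfolding sum_distrib_left[symmetric] by (simp add: power2_eq_square)
  qed simp
  also have "\<dots> = real (Suc n) * x * (fact n * x ^ n)"
    unfolding sum_distrib_left[symmetric] Suc.IH ..
  finally show ?case by (simp add: mult_ac)
qed

section \<open>Lower bounds for the product of weights\<close>

text \<open>For integral \<open>N\<close> the product cannot be negative: a diagram with a box of content below
  \<open>- N\<close> also has one of content exactly \<open>- N\<close>.\<close>

lemma prod_weight_nonneg:
  assumes D: "diagram D"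
  shows "0 \<le> (\<Prod>b\<in>D. weight (real N) b)"
proof (cases "\<exists>b\<in>D. weight (real N) b = 0")
  case True
  then show ?thesis using diagram_finite[OF D] by (simp add: prod_zero)
next
  case False
  show ?thesis
  proof (rule prod_nonneg)
    fix b assume bD: "b \<in> D"
    obtain i j where b: "b = (i, j)" by (cases b)
    have p: "1 \<le> i" "1 \<le> j" using diagram_pos[OF D] bD b by blast+
    show "0 \<le> weight (real N) b"
    proof (rule ccontr)
      assume "\<not> 0 \<le> weight (real N) b"
      then have "j + N < i" unfolding b weight_def by simp
      then have "(j + N, j) \<in> D"
        using diagram_down[OF D, of i j "j + N" j] bD b p by simp
      then show False using False by (force simp: weight_def)
    qed
  qed
qed

text \<open>Each box contributes via ln (1 + y) \<ge> y - 2 y^2 with y its content divided by x. The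
  assumption \<open>2 * m \<le> x\<close> ensures \<bar>y\<bar> \<le> 1/2, where this inequality is
  valid.\<close>

lemma prod_weight_ge_exp:
  assumes fin: "finite D" and N: "0 < x" "2 * m \<le> x"
    and m: "\<And>b. b \<in> D \<Longrightarrow> \<bar>real (snd b) - real (fst b)\<bar> \<le> m"
  shows "exp ((\<Sum>b\<in>D. real (snd b) - real (fst b)) / x - 2 * real (card D) * (m / x)\<^sup>2)
    \<le> (\<Prod>b\<in>D. weight x b) / x ^ card D"
proof -
  let ?y = "\<lambda>b. (real (snd b) - real (fst b)) / x"
  have "exp ((\<Sum>b\<in>D. real (snd b) - real (fst b)) / x - 2 * real (card D) * (m / x)\<^sup>2) =
      exp (\<Sum>b\<in>D. ?y b - 2 * (m / x)\<^sup>2)"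
    by (simp add: sum_subtractf sum_divide_distrib diff_divide_distrib)
  also have "\<dots> = (\<Prod>b\<in>D. exp (?y b - 2 * (m / x)\<^sup>2))"
    using fin by (rule exp_sum)
  also have "\<dots> \<le> (\<Prod>b\<in>D. weight x b / x)"
  proof (rule prod_mono, intro conjI)
    fix b assume b: "b \<in> D"
    have y: "\<bar>?y b\<bar> \<le> m / x" using m[OF b] N by (simp add: divide_right_mono)
    have "m / x \<le> 1 / 2" using N by (simp add: field_simps)
    then have y2: "\<bar>?y b\<bar> \<le> 1 / 2" using y by linarith
    have "(?y b)\<^sup>2 \<le> (m / x)\<^sup>2" using y by (metis abs_ge_zero power2_abs power_mono)
    then have "?y b - 2 * (m / x)\<^sup>2 \<le> ln (1 + ?y b)"
      using abs_ln_one_plus_x_minus_x_bound[OF y2] by linarith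
    moreover have "0 < 1 + ?y b" using y2 by linarith
    ultimately have "exp (?y b - 2 * (m / x)\<^sup>2) \<le> 1 + ?y b"
      by (metis exp_le_cancel_iff exp_ln)
    then show "exp (?y b - 2 * (m / x)\<^sup>2) \<le> weight x b / x"
      using N by (simp add: weight_def add_divide_distrib)
  qed simp
  finally show ?thesis by (simp add: prod_dividef)
qed

section \<open>From partitions as lists to diagrams\<close>

lemma boxes_Sigma: "boxes \<mu> = (SIGMA i:{1..length \<mu>}. {1..nth_part \<mu> i})"
  by (auto simp: boxes_def)

lemma card_boxes: "card (boxes \<mu>) = sum_list \<mu>"
proof -
  have "card (boxes \<mu>) = (\<Sum>i=1..length \<mu>. nth_part \<mu> i)"
    unfolding boxes_Sigma by (subst card_SigmaI) auto
  also have "\<dots> = (\<Sum>i=0..<length \<mu>. \<mu> ! i)"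
    by (rule sum.reindex_bij_witness[of _ Suc "\<lambda>i. i - 1"]) (auto simp: nth_part_def)
  finally show ?thesis by (simp add: sum_list_sum_nth)
qed

lemma nth_part_mono:
  assumes "\<mu> \<in> partitions_of n" "1 \<le> i" "i \<le> i'"
  shows "nth_part \<mu> i' \<le> nth_part \<mu> i"
proof (cases "i = i' \<or> length \<mu> < i'")
  case False
  then have "i - 1 < i' - 1" "i' - 1 < length \<mu>" using assms by auto
  moreover have "sorted_wrt (\<ge>) \<mu>" using assms by (simp add: partitions_of_def)
  ultimately have "\<mu> ! (i' - 1) \<le> \<mu> ! (i - 1)" using sorted_wrt_nth_less by fastforce
  then show ?thesis using assms False by (simp add: nth_part_def)
qed (auto simp: nth_part_def)

lemma diagram_boxes:
  assumes "\<mu> \<in> partitions_of n"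
  shows "diagram (boxes \<mu>)"
proof (rule diagramI)
  show "finite (boxes \<mu>)" unfolding boxes_Sigma by simp
next
  fix i j i' j' assume h: "(i, j) \<in> boxes \<mu>" "1 \<le> i'" "i' \<le> i" "1 \<le> j'" "j' \<le> j"
  then show "(i', j') \<in> boxes \<mu>"
    using nth_part_mono[OF assms h(2,3)] by (simp add: boxes_def)
qed (simp add: boxes_def)

lemma row_length_boxes: "row_length (boxes \<mu>) i = nth_part \<mu> i"
proof -
  have "{j. (i, j) \<in> boxes \<mu>} = {1..nth_part \<mu> i}" by (auto simp: boxes_def nth_part_def)
  then show ?thesis by (simp add: row_length_def)
qed

text \<open>Row lengths recover the parts; since parts are positive, the indices of nonzero rows
  also recover the length of the list.\<close>

lemma inj_on_boxes: "inj_on boxes (partitions_of n)"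
proof (rule inj_onI)
  fix \<mu> \<nu> assume h: "\<mu> \<in> partitions_of n" "\<nu> \<in> partitions_of n" "boxes \<mu> = boxes \<nu>"
  have part: "nth_part \<mu> i = nth_part \<nu> i" for i using h(3) by (metis row_length_boxes)
  have len: "{i. 0 < nth_part \<kappa> i} = {1..length \<kappa>}" if "\<kappa> \<in> partitions_of n" for \<kappa>
    using that by (auto simp: partitions_of_def nth_part_def split: if_splits)
  have "{1..length \<mu>} = {1..length \<nu>}"
    unfolding len[OF h(1), symmetric] len[OF h(2), symmetric] part ..
  then have L: "length \<mu> = length \<nu>" by (metis card_atLeastAtMost diff_Suc_1)
  show "\<mu> = \<nu>"
  proof (rule nth_equalityI[OF L])
    fix k assume "k < length \<mu>"
    then show "\<mu> ! k = \<nu> ! k" using part[of "Suc k"] L by (simp add: nth_part_def)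
  qed
qed

text \<open>Used to enlarge a sum over partitions to one over \<open>diagrams n\<close>, whose
  additional terms are nonnegative.\<close>

lemma boxes_diagrams: "boxes ` partitions_of n \<subseteq> diagrams n"
proof (rule image_subsetI)
  fix \<mu> assume "\<mu> \<in> partitions_of n"
  then show "boxes \<mu> \<in> diagrams n"
    using diagram_boxes by (simp add: diagrams_def card_boxes partitions_of_def)
qed

lemma finite_partitions_of: "finite (partitions_of n)"
  using finite_imageD[OF finite_subset[OF boxes_diagrams finite_diagrams] inj_on_boxes] .

lemma num_syt_eq: "num_syt \<mu> = num_fillings (boxes \<mu>)"
  by (simp add: num_syt_def num_fillings_def standard_tableaux_def increasing_fillings_def card_boxes)

section \<open>Plancherel probabilities and Markov's inequality\<close>

lemma prob_plancherel:
  "\<P>(\<mu> in plancherel n. P \<mu>) =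
    (\<Sum>\<mu>\<in>{\<mu> \<in> partitions_of n. P \<mu>}. (real (num_syt \<mu>))\<^sup>2 / fact n)"
proof -
  have "emeasure (plancherel n) {\<mu> \<in> space (plancherel n). P \<mu>} =
      (\<Sum>\<mu>\<in>{\<mu> \<in> partitions_of n. P \<mu>}. ennreal ((real (num_syt \<mu>))\<^sup>2 / fact n))"
    unfolding plancherel_def space_point_measure
    by (rule emeasure_point_measure_finite) (auto simp: finite_partitions_of)
  also have "\<dots> = ennreal (\<Sum>\<mu>\<in>{\<mu> \<in> partitions_of n. P \<mu>}. (real (num_syt \<mu>))\<^sup>2 / fact n)"
    by (rule sum_ennreal) simp
  finally show ?thesis by (simp add: measure_def sum_nonneg)
qed

text \<open>Markov's inequality for the product of \<open>1 + c(b) / N\<close> over all boxes, whose mean is 1 by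
  \<open>sum_squares_weighted\<close>.\<close>

lemma prob_plancherel_le_exp:
  assumes N: "0 < N"
    and L: "\<And>\<mu>. \<mu> \<in> partitions_of n \<Longrightarrow> P \<mu> \<Longrightarrow>
      exp L \<le> (\<Prod>b\<in>boxes \<mu>. weight (real N) b) / real N ^ n"
  shows "\<P>(\<mu> in plancherel n. P \<mu>) \<le> exp (- L)"
proof -
  let ?A = "{\<mu> \<in> partitions_of n. P \<mu>}"
  let ?g = "\<lambda>D. (real (num_fillings D))\<^sup>2 * (\<Prod>b\<in>D. weight (real N) b)"
  let ?c = "exp (- L) / (fact n * real N ^ n)"
  have pos: "0 \<le> ?c" by simp
  have "\<P>(\<mu> in plancherel n. P \<mu>) \<le> (\<Sum>\<mu>\<in>?A. ?c * ?g (boxes \<mu>))"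
    unfolding prob_plancherel
  proof (rule sum_mono)
    fix \<mu> assume "\<mu> \<in> ?A"
    then have "exp L \<le> (\<Prod>b\<in>boxes \<mu>. weight (real N) b) / real N ^ n" using L by simp
    then have "exp (- L) * exp L \<le> exp (- L) * ((\<Prod>b\<in>boxes \<mu>. weight (real N) b) / real N ^ n)"
      by (rule mult_left_mono) simp
    then have "1 \<le> exp (- L) * ((\<Prod>b\<in>boxes \<mu>. weight (real N) b) / real N ^ n)"
      by (simp flip: exp_add)
    then have "(real (num_syt \<mu>))\<^sup>2 / fact n * 1 \<le> (real (num_syt \<mu>))\<^sup>2 / fact n *
        (exp (- L) * ((\<Prod>b\<in>boxes \<mu>. weight (real N) b) / real N ^ n))"
      by (rule mult_left_mono) simp
    then show "(real (num_syt \<mu>))\<^sup>2 / fact n \<le> ?c * ?g (boxes \<mu>)"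
      by (simp add: num_syt_eq mult_ac)
  qed
  also have "\<dots> = ?c * (\<Sum>D\<in>boxes ` ?A. ?g D)"
    unfolding sum_distrib_left[symmetric]
    by (subst sum.reindex) (auto intro: inj_on_subset[OF inj_on_boxes])
  \<comment> \<open>Dropping the event needs nonnegative products on all diagrams; this is where N
    being a natural number matters.\<close>
  also have "\<dots> \<le> ?c * (\<Sum>D\<in>diagrams n. ?g D)"
  proof (rule mult_left_mono[OF sum_mono2 pos])
    show "boxes ` ?A \<subseteq> diagrams n" using boxes_diagrams by blast
    show "0 \<le> ?g D" if "D \<in> diagrams n - boxes ` ?A" for D
      using that prod_weight_nonneg[of D N] by (simp add: diagrams_def)
  qed (rule finite_diagrams)
  also have "\<dots> = exp (- L)" unfolding sum_squares_weighted using N by simp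
  finally show ?thesis .
qed

section \<open>The tail bound for the content sum\<close>

lemma content_sum_eq: "real_of_int (content_sum \<mu>) = (\<Sum>b\<in>boxes \<mu>. real (snd b) - real (fst b))"
  unfolding content_sum_def of_int_sum by (rule sum.cong) auto

lemma abs_content_le:
  assumes "\<mu> \<in> partitions_of n" "real (max (nth_part \<mu> 1) (length \<mu>)) \<le> m" "b \<in> boxes \<mu>"
  shows "\<bar>real (snd b) - real (fst b)\<bar> \<le> m"
proof -
  obtain i j where b: "b = (i, j)" by (cases b)
  then have "1 \<le> i" "i \<le> length \<mu>" "1 \<le> j" "j \<le> nth_part \<mu> 1"
    using assms nth_part_mono[OF assms(1), of 1 i] by (auto simp: boxes_def)
  then show ?thesis using assms(2) unfolding b by (auto simp: abs_le_iff)
qed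

text \<open>A bound for a single n and a single number t, with an explicit constant and no error
  term.\<close>

lemma prob_content_sum_ge:
  fixes c t :: real
  assumes c1: "1 \<le> c" and t: "0 < t" and n: "1 \<le> n"
  shows "\<P>(\<mu> in plancherel n. real_of_int (content_sum \<mu>) \<ge> real n powr (3 / 2) * t \<and>
      real (max (nth_part \<mu> 1) (length \<mu>)) \<le> c * sqrt (real n))
    \<le> exp (- (1 / (16 * c ^ 6) * real n * t ^ 6))"
    (is "\<P>(\<mu> in _. ?P \<mu>) \<le> _")
proof -
  have c: "0 < c" using c1 by simp
  define s where "s = sqrt (real n)"
  have s: "1 \<le> s" "s * s = real n" using n by (auto simp: s_def)
  have powr: "real n powr (3 / 2) = real n * s"
    using n by (simp add: s_def powr_half_sqrt[symmetric] powr_mult_base)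
  have P: "real n * s * t \<le> (\<Sum>b\<in>boxes \<mu>. real (snd b) - real (fst b))"
    "card (boxes \<mu>) = n"
    "\<And>b. b \<in> boxes \<mu> \<Longrightarrow> \<bar>real (snd b) - real (fst b)\<bar> \<le> c * s"
    if "\<mu> \<in> partitions_of n" "?P \<mu>" for \<mu>
    using that abs_content_le[OF that(1), of "c * s"]
    by (auto simp: content_sum_eq powr card_boxes partitions_of_def s_def[symmetric])
  show ?thesis
  proof (cases "t \<le> c")
    case False
    \<comment> \<open>All contents are at most c s, so their sum is at most n c s, which is less
      than n s t when t > c. The event is empty, and the hypothesis of the Markov bound holds
      vacuously, say for N = 1.\<close>
    have "\<not> ?P \<mu>" if "\<mu> \<in> partitions_of n" for \<mu>
    proof
      assume Pm: "?P \<mu>"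
      have "(\<Sum>b\<in>boxes \<mu>. real (snd b) - real (fst b)) \<le> real n * (c * s)"
        using sum_bounded_above[of "boxes \<mu>" "\<lambda>b. real (snd b) - real (fst b)" "c * s"]
          P(3)[OF that Pm] P(2)[OF that Pm] by (simp add: abs_le_iff)
      then have "real n * s * t \<le> real n * s * c" using P(1)[OF that Pm] by (simp add: mult_ac)
      then show False using False n s by simp
    qed
    then show ?thesis by (intro prob_plancherel_le_exp[of 1]) auto
  next
    case True
    \<comment> \<open>With q = s / N, the exponent obtained below is n (t - 2 c^2 q) q. It is
      largest at q = t / (4 c^2) = 1 / K, so N is K s rounded up.\<close>
    define K where "K = 4 * c\<^sup>2 / t"
    define N where "N = nat \<lceil>K * s\<rceil>"
    have tc: "c * t \<le> c\<^sup>2" "0 < c\<^sup>2" using True c by (simp_all add: power2_eq_square)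
    then have "2 * c * t \<le> 4 * c\<^sup>2" by linarith
    then have K: "2 * c \<le> K" "0 < K"
      using t c by (simp_all add: K_def pos_le_divide_eq)
    have Ks: "0 < K * s" "K * s \<le> real N" "real N < K * s + 1"
      using K s by (auto simp: N_def) linarith+
    then have N: "0 < N" by (metis of_nat_0_less_iff order_less_le_trans)
    have "exp (real n * t\<^sup>2 / (16 * c\<^sup>2))
        \<le> (\<Prod>b\<in>boxes \<mu>. weight (real N) b) / real N ^ n"
      if mu: "\<mu> \<in> partitions_of n" "?P \<mu>" for \<mu>
    proof -
      let ?C = "\<Sum>b\<in>boxes \<mu>. real (snd b) - real (fst b)"
      define q where "q = s / real N"
      have "2 * c * s \<le> K * s" using K s by (intro mult_right_mono) auto
      \<comment> \<open>Since K s \<ge> 2 c s \<ge> 1, rounding up at most doubles K s. Hence q is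
        at least half its optimal value, while q \<le> 1 / K keeps the quadratic loss below t /
        2.\<close>
      then have cs: "2 * (c * s) \<le> real N" "real N \<le> 2 * (K * s)"
        using Ks mult_mono[OF c1 s(1)] c by linarith+
      have q: "0 < q" "q \<le> 1 / K" "1 / (2 * K) \<le> q"
        using s K Ks N cs(2) by (simp_all add: q_def field_simps)
      have "2 * c\<^sup>2 * q \<le> 2 * c\<^sup>2 * (1 / K)" using q tc by (intro mult_left_mono) auto
      also have "\<dots> = t / 2" using t tc by (simp add: K_def)
      finally have half: "2 * c\<^sup>2 * q \<le> t / 2" .
      have "real n * t\<^sup>2 / (16 * c\<^sup>2) = real n * (t / 2) * (1 / (2 * K))"
        using t tc by (simp add: K_def power2_eq_square)
      also have "\<dots> \<le> real n * (t / 2) * q" using q t by (intro mult_left_mono) auto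
      also have "\<dots> \<le> real n * (t - 2 * c\<^sup>2 * q) * q"
        using half q by (intro mult_right_mono mult_left_mono) auto
      also have "\<dots> = real n * s * t / real N - 2 * real n * (c * s / real N)\<^sup>2"
        by (simp add: q_def algebra_simps power2_eq_square)
      also have "\<dots> \<le> ?C / real N - 2 * real (card (boxes \<mu>)) * (c * s / real N)\<^sup>2"
        using P(1,2)[OF mu] by (simp add: divide_right_mono)
      finally have "exp (real n * t\<^sup>2 / (16 * c\<^sup>2)) \<le>
          exp (?C / real N - 2 * real (card (boxes \<mu>)) * (c * s / real N)\<^sup>2)"
        by simp
      also have "\<dots> \<le> (\<Prod>b\<in>boxes \<mu>. weight (real N) b) / real N ^ card (boxes \<mu>)"
        using N cs(1) P(3)[OF mu] diagram_finite[OF diagram_boxes[OF mu(1)]]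
        by (intro prod_weight_ge_exp) auto
      finally show ?thesis using P(2)[OF mu] by simp
    qed
    then have "\<P>(\<mu> in plancherel n. ?P \<mu>) \<le> exp (- (real n * t\<^sup>2 / (16 * c\<^sup>2)))"
      by (rule prob_plancherel_le_exp[OF N])
    \<comment> \<open>In this case t \<le> c, so t^6 \<le> c^4 t^2, which turns the exponent in t^2
      into one in t^6.\<close>
    also have "\<dots> \<le> exp (- (1 / (16 * c ^ 6) * real n * t ^ 6))"
    proof -
      have "t ^ 4 \<le> c ^ 4" using True t by (simp add: power_mono)
      then have "t\<^sup>2 * t ^ 4 \<le> t\<^sup>2 * c ^ 4" by (rule mult_left_mono) simp
      then have "t ^ 6 \<le> t\<^sup>2 * c ^ 4" by (simp flip: power_add)
      then have "real n * t ^ 6 / (16 * c ^ 6) \<le> real n * (t\<^sup>2 * c ^ 4) / (16 * c ^ 6)"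
        using c by (intro divide_right_mono mult_left_mono) simp_all
      also have "\<dots> = real n * t\<^sup>2 / (16 * c\<^sup>2)"
        using c by (simp add: field_simps flip: power_add)
      finally show ?thesis by simp
    qed
    finally show ?thesis .
  qed
qed

theorem theorem2p4:
  fixes c :: real and t :: "nat \<Rightarrow> real"
  assumes "c \<ge> 2"
    and "\<And>n. n \<ge> 1 \<Longrightarrow> t n > 0"
    and "filterlim (\<lambda>n. t n / (ln (real n) / sqrt (real n)) powr (1 / 6)) at_top sequentially"
  shows "\<exists>B>0. \<exists>\<epsilon> :: nat \<Rightarrow> real. \<epsilon> \<longlonglongrightarrow> 0 \<and>
    (\<forall>n\<ge>1. \<P>(\<mu> in plancherel n.
        real_of_int (content_sum \<mu>) \<ge> real n powr (3 / 2) * t n \<and>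
        real (max (nth_part \<mu> 1) (length \<mu>)) \<le> c * sqrt (real n))
      \<le> exp (- (B + \<epsilon> n) * real n * t n ^ 6))"
proof (intro exI conjI allI impI)
  \<comment> \<open>The witnesses are B = 1 / (16 c^6) and the zero sequence, because
    \<open>prob_content_sum_ge\<close> holds for each n \<ge> 1 without an error term.\<close>
  show "0 < 1 / (16 * c ^ 6)" using assms(1) by simp
  show "(\<lambda>_. 0 :: real) \<longlonglongrightarrow> 0" by simp
  fix n :: nat assume "1 \<le> n"
  then show "\<P>(\<mu> in plancherel n.
        real_of_int (content_sum \<mu>) \<ge> real n powr (3 / 2) * t n \<and>
        real (max (nth_part \<mu> 1) (length \<mu>)) \<le> c * sqrt (real n))
      \<le> exp (- (1 / (16 * c ^ 6) + 0) * real n * t n ^ 6)"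
    using prob_content_sum_ge[of c "t n" n] assms(1,2) by simp
qed

end
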